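(* Let $\Sigma$ be a finite alphabet and let $\mathbb{D}$ be a totally-ordered value domain. A property $\varPhi : \Sigma^\omega \to \mathbb{D}$ is safe (respectively, co-safe) if and only if it is threshold safe (respectively, threshold co-safe).
   Context: $\Sigma^*$ and $\Sigma^\omega$ are the sets of finite and infinite words over the finite nonempty alphabet $\Sigma$; $u \prec w$ means that the finite word $u$ is a strict prefix of $w$ (the empty word is allowed). A value domain $\mathbb{D}$ is a complete lattice with $\bot \neq \top$; it is totally ordered if any two elements are comparable. A property is a total function $\varPhi : \Sigma^\omega \to \mathbb{D}$. $\varPhi$ is safe when for every $w \in \Sigma^\omega$ and $v \in \mathbb{D}$ with $\varPhi(w) \not\geq v$, there is $u \prec w$ such that $\sup_{w' \in \Sigma^\omega} \varPhi(uw') \not\geq v$. $\varPhi$ is co-safe when for every $w \in \Sigma^\omega$ and $v \in \mathbb{D}$ with $\varPhi(w) \not\leq v$, there is $u \prec w$ such that $\inf_{w' \in \Sigma^\omega} \varPhi(uw') \not\leq v$. $\varPhi$ is threshold safe when for every $w \in \Sigma^\omega$ and $v \in \mathbb{D}$ with $\varPhi(w) \not\geq v$ there exists $u \prec w$ such that for all $w' \in \Sigma^\omega$ we have $\varPhi(uw') \not\geq v$ (equivalently, for every $v$ the set $\{w : \varPhi(w) \geq v\}$ is closed in the Cantor topology). $\varPhi$ is threshold co-safe when for every $w \in \Sigma^\omega$ and $v \in \mathbb{D}$ with $\varPhi(w) \not\leq v$ there exists $u \prec w$ such that for all $w' \in \Sigma^\omega$ we have $\varPhi(uw') \not\leq v$.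 *)

theory Defs
  imports Main "HOL-Library.Stream"
begin

(* The alphabet is the (finite, nonempty) type 'a; the finite words are the lists over it and
   the infinite words are the streams over it.  A finite prefix of an infinite word is always
   a strict one. *)
definition finite_prefix :: "'a list \<Rightarrow> 'a stream \<Rightarrow> bool"  (infix \<open>\<prec>\<close> 50) where
  "u \<prec> w \<longleftrightarrow> (\<exists>w'. w = u @- w')"

definition safe :: "('a stream \<Rightarrow> 'd::complete_lattice) \<Rightarrow> bool" where
  "safe \<Phi> \<longleftrightarrow>
    (\<forall>w v. \<not> \<Phi> w \<ge> v \<longrightarrow> (\<exists>u. u \<prec> w \<and> \<not> (SUP w'. \<Phi> (u @- w')) \<ge> v))"

definition co_safe :: "('a stream \<Rightarrow> 'd::complete_lattice) \<Rightarrow> bool" where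
  "co_safe \<Phi> \<longleftrightarrow>
    (\<forall>w v. \<not> \<Phi> w \<le> v \<longrightarrow> (\<exists>u. u \<prec> w \<and> \<not> (INF w'. \<Phi> (u @- w')) \<le> v))"

definition threshold_safe :: "('a stream \<Rightarrow> 'd::complete_lattice) \<Rightarrow> bool" where
  "threshold_safe \<Phi> \<longleftrightarrow>
    (\<forall>w v. \<not> \<Phi> w \<ge> v \<longrightarrow> (\<exists>u. u \<prec> w \<and> (\<forall>w'. \<not> \<Phi> (u @- w') \<ge> v)))"

definition threshold_co_safe :: "('a stream \<Rightarrow> 'd::complete_lattice) \<Rightarrow> bool" where
  "threshold_co_safe \<Phi> \<longleftrightarrow>
    (\<forall>w v. \<not> \<Phi> w \<le> v \<longrightarrow> (\<exists>u. u \<prec> w \<and> (\<forall>w'. \<not> \<Phi> (u @- w') \<le> v)))"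

end

theory Submission
  imports Defs
begin

text \<open>
  Suppose \<open>\<Phi> w < v\<close>. If some \<open>c\<close> lies strictly between \<open>\<Phi> w\<close> and \<open>v\<close>, threshold safety at \<open>c\<close>
  yields a prefix all of whose extensions have value below \<open>c\<close>, so their supremum is at most
  \<open>c < v\<close>. Otherwise threshold safety at \<open>v\<close> yields a prefix all of whose extensions have
  value below \<open>v\<close>, hence at most \<open>\<Phi> w\<close>, and the supremum is at most \<open>\<Phi> w < v\<close>. Co-safety is
  dual.
\<close>

text \<open>Each value is at most the supremum, so the same prefix serves.\<close>

lemma safe_imp_threshold_safe:
  assumes "safe \<Phi>"
  shows "threshold_safe \<Phi>"
  using assms unfolding safe_def threshold_safe_def by (meson SUP_upper2 UNIV_I)

lemma co_safe_imp_threshold_co_safe: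
  assumes "co_safe \<Phi>"
  shows "threshold_co_safe \<Phi>"
  using assms unfolding co_safe_def threshold_co_safe_def by (meson INF_lower2 UNIV_I)

text \<open>Strict bounds can become equalities at a supremum; \<open>c\<close> leaves room for
  this. It must not depend on \<open>S\<close>, since it is fixed before the prefix that determines
  \<open>S\<close>.\<close>

lemma less_obtains_Sup_less:
  fixes a v :: "'d::complete_linorder"
  assumes "a < v"
  obtains c where "a < c" and "\<And>S. (\<And>x. x \<in> S \<Longrightarrow> x < c) \<Longrightarrow> Sup S < v"
proof (cases "\<exists>c. a < c \<and> c < v")
  case True
  then obtain c where c: "a < c" "c < v" by blast
  show thesis
  proof (rule that[OF c(1)])
    fix S
    assume "\<And>x. x \<in> S \<Longrightarrow> x < c"
    then have "Sup S \<le> c" by (intro Sup_least less_imp_le)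
    with c(2) show "Sup S < v" by simp
  qed
next
  case False
  \<comment> \<open>Here \<open>c\<close> is \<open>v\<close> itself: by totality and the gap,
    \<open>x < v\<close> forces \<open>x \<le> a\<close>.\<close>
  show thesis
  proof (rule that[OF assms])
    fix S
    assume "\<And>x. x \<in> S \<Longrightarrow> x < v"
    with False have "Sup S \<le> a" by (intro Sup_least) (meson not_less)
    with assms show "Sup S < v" by simp
  qed
qed

lemma less_obtains_less_Inf:
  fixes a v :: "'d::complete_linorder"
  assumes "v < a"
  obtains c where "c < a" and "\<And>S. (\<And>x. x \<in> S \<Longrightarrow> c < x) \<Longrightarrow> v < Inf S"
proof (cases "\<exists>c. v < c \<and> c < a")
  case True
  then obtain c where c: "v < c" "c < a" by blast
  show thesis
  proof (rule that[OF c(2)])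
    fix S
    assume "\<And>x. x \<in> S \<Longrightarrow> c < x"
    then have "c \<le> Inf S" by (intro Inf_greatest less_imp_le)
    with c(1) show "v < Inf S" by simp
  qed
next
  case False
  \<comment> \<open>Again \<open>c\<close> is \<open>v\<close>: across the gap, \<open>v < x\<close>
    forces \<open>a \<le> x\<close>.\<close>
  show thesis
  proof (rule that[OF assms])
    fix S
    assume "\<And>x. x \<in> S \<Longrightarrow> v < x"
    with False have "a \<le> Inf S" by (intro Inf_greatest) (meson not_less)
    with assms show "v < Inf S" by simp
  qed
qed

lemma threshold_safe_imp_safe:
  fixes \<Phi> :: "'a stream \<Rightarrow> 'd::complete_linorder"
  assumes "threshold_safe \<Phi>"
  shows "safe \<Phi>"
  unfolding safe_def not_le
proof (intro allI impI)
  fix w v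
  assume "\<Phi> w < v"
  then obtain c where c: "\<Phi> w < c"
    and sup: "\<And>S. (\<And>x. x \<in> S \<Longrightarrow> x < c) \<Longrightarrow> Sup S < v"
    using less_obtains_Sup_less by blast
  from assms c obtain u where "u \<prec> w" "\<forall>w'. \<Phi> (u @- w') < c"
    unfolding threshold_safe_def not_le by blast
  then show "\<exists>u. u \<prec> w \<and> (SUP w'. \<Phi> (u @- w')) < v"
    using sup[of "range (\<lambda>w'. \<Phi> (u @- w'))"] by blast
qed

lemma threshold_co_safe_imp_co_safe:
  fixes \<Phi> :: "'a stream \<Rightarrow> 'd::complete_linorder"
  assumes "threshold_co_safe \<Phi>"
  shows "co_safe \<Phi>"
  unfolding co_safe_def not_le
proof (intro allI impI)
  fix w v
  assume "v < \<Phi> w"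
  then obtain c where c: "c < \<Phi> w"
    and inf: "\<And>S. (\<And>x. x \<in> S \<Longrightarrow> c < x) \<Longrightarrow> v < Inf S"
    using less_obtains_less_Inf by blast
  \<comment> \<open>The threshold is \<open>c\<close> because \<open>v\<close> might only yield an
    infimum \<open>\<ge> v\<close>.\<close>
  from assms c obtain u where "u \<prec> w" "\<forall>w'. c < \<Phi> (u @- w')"
    unfolding threshold_co_safe_def not_le by blast
  then show "\<exists>u. u \<prec> w \<and> v < (INF w'. \<Phi> (u @- w'))"
    using inf[of "range (\<lambda>w'. \<Phi> (u @- w'))"] by blast
qed

theorem theorem3p16:
  fixes \<Phi> :: "'a::finite stream \<Rightarrow> 'd::complete_linorder"
  assumes "(bot::'d) \<noteq> top"
  shows "(safe \<Phi> \<longleftrightarrow> threshold_safe \<Phi>) \<and> (co_safe \<Phi> \<longleftrightarrow> threshold_co_safe \<Phi>)"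
  using safe_imp_threshold_safe threshold_safe_imp_safe
    co_safe_imp_threshold_co_safe threshold_co_safe_imp_co_safe by blast

end
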